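(* Let $a,b,c,d\ge0$, not all zero, with $a+c=b+d$, and let $C_8$ be the edge correlation function of $\overline P^8_\infty$. For all $(i,t),(i',t')\in\mathbb Z\times\mathbb N$, $$C_8((i,t);(i',t'))=C_8((i',t');(i,t)),$$ $$C_8((0,t);(i',t'))=C_8((1,t);(1-i',t')),$$ $$C_8((i,t);(i',t'))=C_8((i+2,t);(i'+2,t')),$$ $$C_8((i,t);(i',t'))=C_8((i+1,t+1);(i'+1,t'+1)).$$
   Context: $\mathbb N=\{0,1,2,\dots\}$. $\mathrm{PM}(1/2)$ is the law on $\{0,1\}^{\mathbb Z}$ of i.i.d. Bernoulli$(1/2)$ variables indexed by $\mathbb Z$. The law $\mathcal L(\mu;p,r)$, for $\mu$ a probability measure on $\{0,1\}^{\mathbb Z}$ and $p,r\in[0,1]$, is the law of the random field $(e(i,t))_{i\in\mathbb Z,t\in\mathbb N}\in\{0,1\}^{\mathbb Z\times\mathbb N}$ such that $(e(i,0))_{i\in\mathbb Z}\sim\mu$ and $(e(\cdot,t))_{t\ge0}$ is a Markov chain such that, given line $t$, independently for all $i\in\mathbb Z$ with $i+t$ even, the pair $(e(i,t+1),e(i+1,t+1))$ depends only on $(e(i,t),e(i+1,t))$, with, for $k\in\{0,1\}$: $(k,k)\mapsto(k,k)$ with probability $r$ and $(k,k)\mapsto(1-k,1-k)$ with probability $1-r$; $(k,1-k)\mapsto(1-k,k)$ with probability $p$ and $(k,1-k)\mapsto(k,1-k)$ with probability $1-p$. $\overline P^8_\infty=\mathcal L\left(\mathrm{PM}(1/2);\frac{a}{a+c},\frac{b}{b+d}\right)$,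 and for $(e(i,t))\sim\overline P^8_\infty$, $$C_8((i,t);(i',t'))=\frac{\mathrm{Cov}(e(i,t),e(i',t'))}{\sqrt{\mathrm{Var}(e(i,t))}\sqrt{\mathrm{Var}(e(i',t'))}}.$$ *)

theory Defs
  imports "HOL-Probability.Probability"
begin

(* The alphabet {0,1} is modelled by bool, with True for 1 and False for 0; thus 1 - k is \<not> k.
   Spaces of configurations carry the product sigma-algebra. *)

type_synonym line = "int \<Rightarrow> bool"
type_synonym field = "int \<times> nat \<Rightarrow> bool"

abbreviation line_space :: "line measure" where
  "line_space \<equiv> Pi\<^sub>M UNIV (\<lambda>_. count_space UNIV)"

abbreviation field_space :: "field measure" where
  "field_space \<equiv> Pi\<^sub>M UNIV (\<lambda>_. count_space UNIV)"

definition PM :: "real \<Rightarrow> line measure" where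
  "PM q = Pi\<^sub>M UNIV (\<lambda>_. measure_pmf (bernoulli_pmf q))"

definition pair_step :: "real \<Rightarrow> real \<Rightarrow> bool \<Rightarrow> bool \<Rightarrow> (bool \<times> bool) pmf" where
  "pair_step p r x y =
     (if x = y then map_pmf (\<lambda>s. if s then (x, x) else (\<not> x, \<not> x)) (bernoulli_pmf r)
      else map_pmf (\<lambda>s. if s then (y, x) else (x, y)) (bernoulli_pmf p))"

(* One step of the chain, from line t to line t + 1: the pairs at positions (i, i + 1) with i + t
   even partition the line and are updated independently; z i is the new value of the pair at
   (i, i + 1). *)

definition line_step :: "real \<Rightarrow> real \<Rightarrow> nat \<Rightarrow> line \<Rightarrow> line measure" where
  "line_step p r t l =
     distr (Pi\<^sub>M {i. even (i + int t)} (\<lambda>i. measure_pmf (pair_step p r (l i) (l (i + 1)))))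
       line_space
       (\<lambda>z j. if even (j + int t) then fst (z j) else snd (z (j - 1)))"

(* Conditional law of line n given the lines h 0, ..., h (n - 1). *)

definition line_kernel :: "line measure \<Rightarrow> real \<Rightarrow> real \<Rightarrow> nat \<Rightarrow> (nat \<Rightarrow> line) \<Rightarrow> line measure" where
  "line_kernel \<mu> p r n h = (case n of 0 \<Rightarrow> \<mu> | Suc t \<Rightarrow> line_step p r t (h t))"

(* The law of the whole Markov chain of lines, as given by the Ionescu-Tulcea theorem. *)

definition chain_law :: "line measure \<Rightarrow> real \<Rightarrow> real \<Rightarrow> (nat \<Rightarrow> line) measure" where
  "chain_law \<mu> p r =
     projective_family.lim UNIV
       (Ionescu_Tulcea.CI (line_kernel \<mu> p r) (\<lambda>_. line_space)) (\<lambda>_. line_space)"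

definition field_law :: "line measure \<Rightarrow> real \<Rightarrow> real \<Rightarrow> field measure" where
  "field_law \<mu> p r = distr (chain_law \<mu> p r) field_space (\<lambda>h (i, t). h t i)"

definition P8 :: "real \<Rightarrow> real \<Rightarrow> real \<Rightarrow> real \<Rightarrow> field measure" where
  "P8 a b c d = field_law (PM (1 / 2)) (a / (a + c)) (b / (b + d))"

definition covariance :: "'a measure \<Rightarrow> ('a \<Rightarrow> real) \<Rightarrow> ('a \<Rightarrow> real) \<Rightarrow> real" where
  "covariance M X Y = (\<integral>\<omega>. (X \<omega> - (\<integral>x. X x \<partial>M)) * (Y \<omega> - (\<integral>x. Y x \<partial>M)) \<partial>M)"

definition C8 :: "real \<Rightarrow> real \<Rightarrow> real \<Rightarrow> real \<Rightarrow> int \<times> nat \<Rightarrow> int \<times> nat \<Rightarrow> real" where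
  "C8 a b c d u v =
     covariance (P8 a b c d) (\<lambda>e. of_bool (e u)) (\<lambda>e. of_bool (e v)) /
       (sqrt (prob_space.variance (P8 a b c d) (\<lambda>e. of_bool (e u))) *
        sqrt (prob_space.variance (P8 a b c d) (\<lambda>e. of_bool (e v))))"

(* The kernels satisfy the hypotheses of the Ionescu-Tulcea theorem, so that the laws above are
   indeed those of the processes described. *)

lemma measurable_line_count:
  "(\<lambda>l::line. f (l i) (l j)) \<in> borel_measurable line_space" for f :: "bool \<Rightarrow> bool \<Rightarrow> ennreal"
proof -
  have "(\<lambda>l::line. (l i, l j)) \<in> measurable line_space (count_space UNIV \<Otimes>\<^sub>M count_space UNIV)"
    by measurable
  then have "(\<lambda>l::line. (l i, l j)) \<in> measurable line_space (count_space UNIV)"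
    by (simp add: pair_measure_countable)
  then have "(\<lambda>l::line. case_prod f (l i, l j)) \<in> borel_measurable line_space"
    by (rule measurable_compose) simp
  then show ?thesis by simp
qed

lemma measurable_line_step:
  "line_step p r t \<in> measurable line_space (prob_algebra line_space)"
proof -
  let ?I = "{i. even (i + int t)}"
  let ?Q = "\<lambda>l i. measure_pmf (pair_step p r (l i) (l (i + 1)))"
  let ?M = "\<lambda>_::int. count_space (UNIV :: (bool \<times> bool) set)"
  have sets_Q: "sets (Pi\<^sub>M ?I (?Q l)) = sets (Pi\<^sub>M ?I ?M)" for l
    by (rule sets_PiM_cong) auto
  have pQ: "prob_space (Pi\<^sub>M ?I (?Q l))" for l
    by (rule prob_space_PiM) (rule prob_space_measure_pmf)
  have "(\<lambda>l. Pi\<^sub>M ?I (?Q l)) \<in> measurable line_space (prob_algebra (Pi\<^sub>M ?I ?M))"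
  proof (rule measurable_prob_algebra_generated[OF sets_PiM Int_stable_prod_algebra
        prod_algebra_sets_into_space])
    fix A assume "A \<in> prod_algebra ?I ?M"
    then obtain J E where JE: "A = prod_emb ?I ?M J (Pi\<^sub>E J E)" "finite J" "J \<subseteq> ?I"
      by (elim prod_algebraE) blast
    have "emeasure (Pi\<^sub>M ?I (?Q l)) A = (\<Prod>j\<in>J. emeasure (?Q l j) (E j))" for l
    proof -
      interpret product_prob_space "?Q l" ?I ..
      have "A = prod_emb ?I (?Q l) J (Pi\<^sub>E J E)"
        by (auto simp: JE prod_emb_def)
      then show ?thesis using JE by (simp only: emeasure_PiM_emb[OF JE(3,2)] sets_measure_pmf UNIV_I Pow_UNIV)
    qed
    then show "(\<lambda>l. emeasure (Pi\<^sub>M ?I (?Q l)) A) \<in> borel_measurable line_space"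
      by (simp add: borel_measurable_prod measurable_line_count)
  qed (use sets_Q pQ in auto)
  moreover have "(\<lambda>z j. if even (j + int t) then fst (z j) else snd (z (j - 1)))
      \<in> measurable (Pi\<^sub>M ?I ?M) line_space"
  proof (rule measurable_PiM_single')
    fix j :: int
    show "(\<lambda>z. if even (j + int t) then fst (z j) else snd (z (j - 1)))
      \<in> measurable (Pi\<^sub>M ?I ?M) (count_space UNIV)"
      by (cases "even (j + int t)")
         (auto intro!: measurable_compose[OF measurable_component_singleton])
  qed auto
  ultimately show ?thesis
    unfolding line_step_def[abs_def]
    by (intro measurable_compose[OF _ measurable_distr_prob_space])
qed

lemma line_kernel_Ionescu_Tulcea:
  assumes "\<mu> \<in> space (prob_algebra line_space)"
  shows "Ionescu_Tulcea (line_kernel \<mu> p r) (\<lambda>_. line_space)"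
proof -
  have *: "line_kernel \<mu> p r n
      \<in> measurable (Pi\<^sub>M {0..<n} (\<lambda>_. line_space)) (prob_algebra line_space)" for n
  proof (cases n)
    case 0
    then show ?thesis using assms by (simp add: line_kernel_def[abs_def])
  next
    case (Suc t)
    have "(\<lambda>h. h t) \<in> measurable (Pi\<^sub>M {0..<n} (\<lambda>_. line_space)) line_space"
      using Suc by (intro measurable_component_singleton) simp
    from measurable_compose[OF this measurable_line_step] show ?thesis
      using Suc by (simp add: line_kernel_def[abs_def])
  qed
  show ?thesis
  proof (rule Ionescu_Tulcea.intro)
    show "line_kernel \<mu> p r n
      \<in> measurable (Pi\<^sub>M {0..<n} (\<lambda>_. line_space)) (subprob_algebra line_space)" for n
      by (rule measurable_prob_algebraD[OF *])
    show "prob_space (line_kernel \<mu> p r n h)"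
      if "h \<in> space (Pi\<^sub>M {0..<n} (\<lambda>_. line_space))" for n h
      using measurable_space[OF * that] by (simp add: space_prob_algebra)
  qed
qed

lemma PM_in_prob_algebra: "PM q \<in> space (prob_algebra line_space)"
  unfolding PM_def space_prob_algebra
  by (auto intro!: sets_PiM_cong prob_space_PiM prob_space_measure_pmf)

end

theory Submission
  imports Defs
begin

text \<open>The update of a pair maps the uniform law on \<open>{0,1}\<^sup>2\<close> to itself whatever \<open>p\<close> and \<open>r\<close> are, so
  PM(1/2) is stationary and the law of the lines \<open>(t, t + k)\<close> is PM(1/2) followed by \<open>k\<close> steps from time
  \<open>t\<close>. A shift of the line by \<open>s\<close> intertwines the step at time \<open>t + s\<close> with the one at time \<open>t\<close> up to
  parity, the reflection \<open>i \<mapsto> 1 - i\<close> maps update pairs to update pairs and commutes with the update rule,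
  and both preserve PM(1/2). Hence they preserve all two-point probabilities, of which \<open>C8\<close> is a function.\<close>

section \<open>Product laws over the update pairs, and their symmetries\<close>

text \<open>Allowing arbitrary pair laws \<open>Q\<close> puts one step of the chain and
  \<open>PM q\<close> under the same form, so that each symmetry is checked once for both.\<close>

definition pair_product :: "nat \<Rightarrow> (int \<Rightarrow> (bool \<times> bool) pmf) \<Rightarrow> line measure" where
  "pair_product t Q =
     distr (Pi\<^sub>M {i. even (i + int t)} (\<lambda>i. measure_pmf (Q i))) line_space
       (\<lambda>z j. if even (j + int t) then fst (z j) else snd (z (j - 1)))"

text \<open>\<open>J\<close> is meant to hold left endpoints of update pairs. These pairs are
  disjoint, so a single family \<open>A\<close> indexed by sites can prescribe any rectangle for
  each pair.\<close>

definition pair_cylinder :: "int set \<Rightarrow> (int \<Rightarrow> bool set) \<Rightarrow> line set" where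
  "pair_cylinder J A = {l. \<forall>j\<in>J. (l j, l (j + 1)) \<in> A j \<times> A (j + 1)}"

lemma line_step_eq_pair_product:
  "line_step p r t l = pair_product t (\<lambda>i. pair_step p r (l i) (l (i + 1)))"
  by (simp add: line_step_def pair_product_def)

lemma space_line_space [simp]: "space line_space = UNIV"
  by (simp add: space_PiM)

lemma measurable_unpair:
  "(\<lambda>z j. if even (j + int t) then fst (z j) else snd (z (j - 1)))
     \<in> measurable (Pi\<^sub>M {i. even (i + int t)} (\<lambda>i. measure_pmf (Q i))) line_space"
proof (rule measurable_PiM_single')
  fix j :: int
  have proj: "(\<lambda>z. f (z i)) \<in> measurable (Pi\<^sub>M {i. even (i + int t)} (\<lambda>i. measure_pmf (Q i))) (count_space UNIV)"
    if "even (i + int t)" for f :: "bool \<times> bool \<Rightarrow> bool" and i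
    using that
    by (intro measurable_compose[where g=f, OF measurable_component_singleton[of i _ "\<lambda>i. measure_pmf (Q i)"]]) simp_all
  show "(\<lambda>z. if even (j + int t) then fst (z j) else snd (z (j - 1)))
      \<in> measurable (Pi\<^sub>M {i. even (i + int t)} (\<lambda>i. measure_pmf (Q i))) (count_space UNIV)"
    using proj[of j fst] proj[of "j - 1" snd] by (cases "even (j + int t)") auto
qed auto

lemma sets_pair_product [simp, measurable_cong]: "sets (pair_product t Q) = sets line_space"
  by (simp add: pair_product_def)

lemma prob_space_pair_product: "prob_space (pair_product t Q)"
  unfolding pair_product_def
  by (intro prob_space.prob_space_distr prob_space_PiM measurable_unpair prob_space_measure_pmf)

lemma sets_pair_cylinder: "finite J \<Longrightarrow> pair_cylinder J A \<in> sets line_space"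
proof -
  assume "finite J"
  have "pair_cylinder J A = (\<Inter>j\<in>J. {l \<in> space line_space. l j \<in> A j \<and> l (j + 1) \<in> A (j + 1)}) \<inter> space line_space"
    by (auto simp: pair_cylinder_def)
  also have "\<dots> \<in> sets line_space"
    using \<open>finite J\<close>
    by (cases "J = {}") (auto intro!: sets.finite_INT sets.sets_Collect_conj sets_Collect_single' simp del: space_line_space)
  finally show ?thesis .
qed

text \<open>For \<open>j + int t\<close> even, sites \<open>j\<close> and \<open>j + 1\<close> of
  the unpaired line are the two components of \<open>z j\<close>. The preimage of the pair cylinder
  is therefore a product cylinder over \<open>J\<close>.\<close>

lemma emeasure_pair_product:
  assumes "finite J" "J \<subseteq> {i. even (i + int t)}"
  shows "emeasure (pair_product t Q) (pair_cylinder J A)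
    = (\<Prod>j\<in>J. emeasure (measure_pmf (Q j)) (A j \<times> A (j + 1)))"
proof -
  let ?I = "{i. even (i + int t)}" and ?Q = "\<lambda>i. measure_pmf (Q i)"
  have "emeasure (pair_product t Q) (pair_cylinder J A)
      = emeasure (Pi\<^sub>M ?I ?Q) (prod_emb ?I ?Q J (Pi\<^sub>E J (\<lambda>j. A j \<times> A (j + 1))))"
    unfolding pair_product_def using assms
    by (subst emeasure_distr[OF measurable_unpair sets_pair_cylinder])
       (auto simp: pair_cylinder_def prod_emb_def space_PiM mem_Times_iff PiE_iff
         subset_iff Ball_def intro!: arg_cong2[where f=emeasure])
  also have "\<dots> = (\<Prod>j\<in>J. emeasure (?Q j) (A j \<times> A (j + 1)))"
    using assms by (intro emeasure_PiM_emb) (auto intro: prob_space_measure_pmf)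
  finally show ?thesis .
qed

text \<open>Pair cylinders determine a law on lines, because every finite cylinder becomes one after
  the missing partners of its sites are added without constraint.\<close>

lemma eq_pair_productI:
  assumes [simp]: "sets N = sets line_space"
    and eq: "\<And>J A. finite J \<Longrightarrow> J \<subseteq> {i. even (i + int t)} \<Longrightarrow>
      emeasure N (pair_cylinder J A) = (\<Prod>j\<in>J. emeasure (measure_pmf (Q j)) (A j \<times> A (j + 1)))"
  shows "N = pair_product t Q"
proof (rule measure_eqI_PiM_infinite[symmetric])
  show "finite_measure (pair_product t Q)"
    by (rule prob_space.finite_measure[OF prob_space_pair_product])
next
  fix A :: "int \<Rightarrow> bool set" and J :: "int set"
  assume J: "finite J"
  \<comment> \<open>Left endpoints of the update pairs that meet \<open>J\<close>: a site of the
    wrong parity is the right endpoint of the pair starting one site earlier.\<close>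
  define J' where "J' = {i. even (i + int t)} \<inter> (J \<union> (\<lambda>j. j - 1) ` J)"
  define A' where "A' j = (if j \<in> J then A j else UNIV)" for j
  have "finite J'" using J by (simp add: J'_def)
  have "prod_emb UNIV (\<lambda>_. count_space UNIV) J (Pi\<^sub>E J A) = pair_cylinder J' A'" (is "?L = ?R")
  proof -
    have "(\<forall>j\<in>J. l j \<in> A j) \<longleftrightarrow> (\<forall>j\<in>J'. l j \<in> A' j \<and> l (j + 1) \<in> A' (j + 1))" for l
    proof
      assume r: "\<forall>j\<in>J'. l j \<in> A' j \<and> l (j + 1) \<in> A' (j + 1)"
      show "\<forall>j\<in>J. l j \<in> A j"
      proof
        fix j assume j: "j \<in> J"
        show "l j \<in> A j"
        proof (cases "even (j + int t)")
          case True
          then have "j \<in> J'" using j by (simp add: J'_def)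
          with r j show ?thesis by (force simp: A'_def)
        next
          case False
          then have "j - 1 \<in> J'" using j by (simp add: J'_def)
          with r j show ?thesis by (force simp: A'_def)
        qed
      qed
    qed (auto simp: A'_def)
    then show ?thesis by (auto simp: prod_emb_def pair_cylinder_def PiE_iff)
  qed
  then show "emeasure (pair_product t Q) (prod_emb UNIV (\<lambda>_. count_space UNIV) J (Pi\<^sub>E J A))
      = emeasure N (prod_emb UNIV (\<lambda>_. count_space UNIV) J (Pi\<^sub>E J A))"
    using \<open>finite J'\<close> by (simp add: J'_def emeasure_pair_product eq)
qed auto

lemma measurable_relabel: "(\<lambda>l j. l (\<sigma> j)) \<in> measurable line_space line_space"
  by (rule measurable_PiM_single') auto

text \<open>The parity condition says that translation by \<open>s\<close> carries the pairs of time
  \<open>t\<close> onto the pairs of time \<open>u\<close>.\<close>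

lemma shift_pair_product:
  "distr (pair_product u Q) line_space (\<lambda>l j. l (j + s)) = pair_product t (\<lambda>i. Q (i + s))"
  if "even (s + int u + int t)" for s :: int
proof (rule eq_pair_productI)
  fix J :: "int set" and A :: "int \<Rightarrow> bool set"
  assume J: "finite J" "J \<subseteq> {i. even (i + int t)}"
  have "(\<lambda>l j. l (j + s)) -` pair_cylinder J A = pair_cylinder ((\<lambda>j. j + s) ` J) (\<lambda>j. A (j - s))"
    by (auto simp: pair_cylinder_def algebra_simps)
  moreover have "(\<lambda>j. j + s) ` J \<subseteq> {i. even (i + int u)}"
    using J(2) that by auto
  ultimately show "emeasure (distr (pair_product u Q) line_space (\<lambda>l j. l (j + s))) (pair_cylinder J A)
      = (\<Prod>j\<in>J. emeasure (measure_pmf (Q (j + s))) (A j \<times> A (j + 1)))"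
    using J by (simp add: emeasure_distr measurable_relabel sets_pair_cylinder
      measurable_cong_sets[OF sets_pair_product] sets_eq_imp_space_eq[OF sets_pair_product]
      emeasure_pair_product prod.reindex inj_on_def algebra_simps)
qed simp

text \<open>The reflection sends the sites \<open>j\<close>, \<open>j + 1\<close> to
  \<open>1 - j\<close>, \<open>- j\<close>. This is the pair with left endpoint \<open>- j\<close>,
  of the same parity, read in the opposite order; hence the swap.\<close>

lemma reflect_pair_product:
  "distr (pair_product t Q) line_space (\<lambda>l j. l (1 - j))
    = pair_product t (\<lambda>i. map_pmf prod.swap (Q (- i)))"
proof (rule eq_pair_productI)
  fix J :: "int set" and A :: "int \<Rightarrow> bool set"
  assume J: "finite J" "J \<subseteq> {i. even (i + int t)}"
  have "(\<lambda>l j. l (1 - j)) -` pair_cylinder J A = pair_cylinder (uminus ` J) (\<lambda>j. A (1 - j))"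
    by (auto simp: pair_cylinder_def algebra_simps)
  moreover have "uminus ` J \<subseteq> {i. even (i + int t)}"
    using J(2) by auto
  moreover have "prod.swap -` (A j \<times> A (j + 1)) = A (j + 1) \<times> A j" for j
    by auto
  ultimately show "emeasure (distr (pair_product t Q) line_space (\<lambda>l j. l (1 - j))) (pair_cylinder J A)
      = (\<Prod>j\<in>J. emeasure (measure_pmf (map_pmf prod.swap (Q (- j)))) (A j \<times> A (j + 1)))"
    using J by (simp add: emeasure_distr measurable_relabel sets_pair_cylinder
      measurable_cong_sets[OF sets_pair_product] sets_eq_imp_space_eq[OF sets_pair_product]
      emeasure_pair_product prod.reindex inj_on_def algebra_simps)
qed simp

text \<open>Independent sites stay independent when grouped in pairs. As \<open>t\<close> is
  arbitrary, the grouping can always be matched to that of the step under study.\<close>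

lemma PM_eq_pair_product:
  "PM q = pair_product t (\<lambda>_. pair_pmf (bernoulli_pmf q) (bernoulli_pmf q))"
proof (rule eq_pair_productI)
  fix J :: "int set" and A :: "int \<Rightarrow> bool set"
  assume J: "finite J" "J \<subseteq> {i. even (i + int t)}"
  let ?B = "measure_pmf (bernoulli_pmf q)" and ?S = "\<lambda>j::int. j + 1"
  \<comment> \<open>All left endpoints share one parity, so no site is both a left and a right
    endpoint and the product over sites splits.\<close>
  have disj: "J \<inter> ?S ` J = {}"
  proof -
    have "j + 1 \<notin> J" if "j \<in> J" for j
    proof
      assume "j + 1 \<in> J"
      with J(2) that have "even (j + int t)" "even (j + 1 + int t)" by blast+
      then show False by simp
    qed
    then show ?thesis by blast
  qed
  have "pair_cylinder J A = prod_emb UNIV (\<lambda>_. ?B) (J \<union> ?S ` J) (Pi\<^sub>E (J \<union> ?S ` J) A)"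
    by (auto simp: pair_cylinder_def prod_emb_def PiE_iff)
  then have "emeasure (PM q) (pair_cylinder J A) = (\<Prod>j\<in>J \<union> ?S ` J. emeasure ?B (A j))"
    unfolding PM_def using J
    by (simp only:) (subst emeasure_PiM_emb, auto intro: prob_space_measure_pmf)
  also have "\<dots> = (\<Prod>j\<in>J. emeasure ?B (A j) * emeasure ?B (A (j + 1)))"
    using J disj by (simp add: prod.union_disjoint prod.reindex inj_on_def prod.distrib)
  also have "\<dots> = (\<Prod>j\<in>J. emeasure (measure_pmf (pair_pmf (bernoulli_pmf q) (bernoulli_pmf q)))
      (A j \<times> A (j + 1)))"
    by (simp add: measure_pmf.emeasure_eq_measure measure_pmf_prob_product ennreal_mult)
  finally show "emeasure (PM q) (pair_cylinder J A) = \<dots>" .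
qed (auto simp: PM_def intro!: sets_PiM_cong)

section \<open>Stationarity of PM(1/2) under one step\<close>

lemma pmf_map_bool:
  fixes q :: "bool pmf"
  shows "pmf (map_pmf f q) z = of_bool (f True = z) * pmf q True + of_bool (f False = z) * pmf q False"
proof -
  have "pmf (map_pmf f q) z = (\<Sum>x\<in>UNIV. if x \<in> f -` {z} then pmf q x else 0)"
    by (simp add: pmf_map measure_measure_pmf_finite sum.If_cases vimage_def)
  then show ?thesis by (simp add: UNIV_bool)
qed

text \<open>The transition matrix on pairs is doubly stochastic: an equal pair is reached from
  itself and from its complement with probabilities summing to 1, and likewise an unequal pair from
  itself and its swap.\<close>

lemma bind_pair_step_uniform:
  "bind_pmf (pair_pmf (bernoulli_pmf (1/2)) (bernoulli_pmf (1/2))) (\<lambda>(x, y). pair_step p r x y)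
    = pair_pmf (bernoulli_pmf (1/2)) (bernoulli_pmf (1/2))" (is "bind_pmf ?U ?f = _")
proof (rule pmf_eqI)
  fix z :: "bool \<times> bool"
  have U: "pmf ?U w = 1 / 4" for w
    by (cases w; cases "fst w"; cases "snd w") (auto simp: pmf_pair)
  have "pmf (bind_pmf ?U ?f) z = (\<Sum>w\<in>UNIV. pmf (?f w) z * pmf ?U w)"
    by (simp add: pmf_bind integral_measure_pmf_real[where A=UNIV])
  also have "\<dots> = (\<Sum>x\<in>UNIV. \<Sum>y\<in>UNIV. pmf (pair_step p r x y) z) / 4"
    by (simp add: U sum_divide_distrib UNIV_Times_UNIV[symmetric] sum.cartesian_product case_prod_beta del:
        UNIV_Times_UNIV)
  also have "(\<Sum>x\<in>UNIV. \<Sum>y\<in>UNIV. pmf (pair_step p r x y) z) = 1"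
    by (cases z; cases "fst z"; cases "snd z")
       (simp_all add: UNIV_bool pair_step_def pmf_map_bool pmf_False_conv_True)
  finally show "pmf (bind_pmf ?U ?f) z = pmf ?U z" by (simp add: U)
qed

lemma measurable_line_step_subprob [measurable]:
  "line_step p r t \<in> measurable line_space (subprob_algebra line_space)"
  by (rule measurable_prob_algebraD[OF measurable_line_step])

lemma sets_PM [simp, measurable_cong]: "sets (PM q) = sets line_space"
  by (auto simp: PM_def intro!: sets_PiM_cong)

text \<open>Grouped by the parity of \<open>t\<close>, the initial line consists of independent
  uniform pairs. The probability of a pair cylinder after the step thus factorises over pairs, and
  each factor is given by \<open>bind_pair_step_uniform\<close>.\<close>

lemma bind_PM_line_step: "PM (1/2) \<bind> line_step p r t = PM (1/2)"
proof -
  let ?U = "pair_pmf (bernoulli_pmf (1/2)) (bernoulli_pmf (1/2))"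
  let ?I = "{i. even (i + int t)}"
  have sp: "space (PM (1/2)) = UNIV"
    using sets_eq_imp_space_eq[OF sets_PM] by simp
  have meas: "line_step p r t \<in> measurable (PM (1/2)) (subprob_algebra line_space)"
    by (simp cong: measurable_cong_sets)
  have "PM (1/2) \<bind> line_step p r t = pair_product t (\<lambda>_. ?U)"
  proof (rule eq_pair_productI)
    show "sets (PM (1/2) \<bind> line_step p r t) = sets line_space"
      by (rule sets_bind[OF sets_kernel[OF meas]]) (auto simp: sp)
  next
    fix J :: "int set" and A :: "int \<Rightarrow> bool set"
    assume J: "finite J" "J \<subseteq> ?I"
    \<comment> \<open>The probability that the pair at \<open>j\<close>, starting from
      \<open>w\<close>, lands in its prescribed rectangle.\<close>
    define h where "h j w = emeasure (measure_pmf (pair_step p r (fst w) (snd w))) (A j \<times> A (j + 1))" for j w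
    interpret U: product_prob_space "\<lambda>_. measure_pmf ?U" ?I ..
    have "emeasure (PM (1/2) \<bind> line_step p r t) (pair_cylinder J A)
        = (\<integral>\<^sup>+l. emeasure (line_step p r t l) (pair_cylinder J A) \<partial>PM (1/2))"
      by (rule emeasure_bind[OF _ meas]) (use J sp in \<open>auto simp: sets_pair_cylinder\<close>)
    also have "\<dots> = (\<integral>\<^sup>+l. (\<Prod>j\<in>J. h j (l j, l (j + 1))) \<partial>PM (1/2))"
      using J by (simp add: line_step_eq_pair_product emeasure_pair_product h_def)
    also have "\<dots> = (\<integral>\<^sup>+z. (\<Prod>j\<in>J. h j (z j)) \<partial>Pi\<^sub>M ?I (\<lambda>_. measure_pmf ?U))"
    proof -
      have "(\<lambda>l. \<Prod>j\<in>J. h j (l j, l (j + 1))) \<in> borel_measurable line_space"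
        by (intro borel_measurable_prod_ennreal measurable_line_count[of "\<lambda>x y. h _ (x, y)"])
      then show ?thesis
        unfolding PM_eq_pair_product[of _ t] pair_product_def
        using J by (subst nn_integral_distr[OF measurable_unpair])
          (auto intro!: nn_integral_cong prod.cong)
    qed
    \<comment> \<open>Only the pairs in \<open>J\<close> matter; passing to this finite marginal
      makes the integral of a product split into a product of integrals.\<close>
    also have "\<dots> = (\<integral>\<^sup>+z. (\<Prod>j\<in>J. h j (z j)) \<partial>distr (Pi\<^sub>M ?I (\<lambda>_. measure_pmf ?U))
        (Pi\<^sub>M J (\<lambda>_. measure_pmf ?U)) (\<lambda>z. restrict z J))"
      using J by (subst nn_integral_distr)
          (auto intro!: nn_integral_cong prod.cong measurable_restrict_subset borel_measurable_prod
        measurable_compose[OF measurable_component_singleton])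
    also have "\<dots> = (\<integral>\<^sup>+z. (\<Prod>j\<in>J. h j (z j)) \<partial>Pi\<^sub>M J (\<lambda>_. measure_pmf ?U))"
      by (simp only: U.distr_PiM_restrict_finite[OF J])
    also have "\<dots> = (\<Prod>j\<in>J. \<integral>\<^sup>+w. h j w \<partial>measure_pmf ?U)"
      using J by (intro U.product_nn_integral_prod) auto
    also have "\<dots> = (\<Prod>j\<in>J. emeasure (measure_pmf ?U) (A j \<times> A (j + 1)))"
    proof (rule prod.cong[OF refl])
      fix j
      have "(\<integral>\<^sup>+w. h j w \<partial>measure_pmf ?U)
          = emeasure (measure_pmf (bind_pmf ?U (\<lambda>(x, y). pair_step p r x y))) (A j \<times> A (j + 1))"
        by (simp only: emeasure_bind_pmf h_def case_prod_beta)
      then show "(\<integral>\<^sup>+w. h j w \<partial>measure_pmf ?U) = emeasure (measure_pmf ?U) (A j \<times> A (j + 1))"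
        by (simp only: bind_pair_step_uniform)
    qed
    finally show "emeasure (PM (1/2) \<bind> line_step p r t) (pair_cylinder J A) = \<dots>" .
  qed
  then show ?thesis by (simp only: PM_eq_pair_product[of _ t, symmetric])
qed

lemma nn_integral_PM_line_step:
  assumes [measurable]: "G \<in> borel_measurable line_space"
  shows "(\<integral>\<^sup>+l. \<integral>\<^sup>+x. G x \<partial>line_step p r t l \<partial>PM (1/2)) = (\<integral>\<^sup>+x. G x \<partial>PM (1/2))"
proof -
  have "(\<integral>\<^sup>+x. G x \<partial>(PM (1/2) \<bind> line_step p r t)) = (\<integral>\<^sup>+l. \<integral>\<^sup>+x. G x \<partial>line_step p r t l \<partial>PM (1/2))"
    by (rule nn_integral_bind[where B=line_space]) (simp_all cong: measurable_cong_sets)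
  then show ?thesis by (simp add: bind_PM_line_step)
qed

section \<open>Invariance of PM and of the step under shift and reflection\<close>

lemma shift_PM: "distr (PM q) line_space (\<lambda>l j. l (j + s)) = PM q"
proof -
  \<comment> \<open>\<open>PM q\<close> is a pair product at every time, so any time with the parity
    of \<open>s\<close> can be the source when the target is time 0; the absolute value supplies a
    natural one.\<close>
  have "even (s + int (nat \<bar>s\<bar>) + int 0)" by simp
  from shift_pair_product[OF this] show ?thesis
    by (subst PM_eq_pair_product[of q "nat \<bar>s\<bar>"], subst PM_eq_pair_product[of q 0])
qed

lemma reflect_PM: "distr (PM q) line_space (\<lambda>l j. l (1 - j)) = PM q"
proof -
  have "map_pmf prod.swap (pair_pmf (bernoulli_pmf q) (bernoulli_pmf q))
      = pair_pmf (bernoulli_pmf q) (bernoulli_pmf q)"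
    using pair_commute_pmf[of "bernoulli_pmf q" "bernoulli_pmf q"]
    by (metis (no_types, lifting) case_prod_beta' ext prod.swap_def)
  then show ?thesis
    by (simp add: PM_eq_pair_product[of q 0] reflect_pair_product)
qed

lemma shift_line_step:
  assumes "even (s + int u + int t)"
  shows "distr (line_step p r u l) line_space (\<lambda>l j. l (j + s)) = line_step p r t (\<lambda>j. l (j + s))"
  unfolding line_step_eq_pair_product shift_pair_product[OF assms] by (simp add: ac_simps)

lemma swap_pair_step: "map_pmf prod.swap (pair_step p r x y) = pair_step p r y x"
  by (cases x; cases y) (simp_all add: pair_step_def pmf.map_comp o_def if_distrib cong: if_cong)

text \<open>The pair at \<open>i\<close> of the reflected line is the swapped pair at
  \<open>- i\<close> of \<open>l\<close>, and \<open>swap_pair_step\<close> says that the update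
  rule commutes with the swap.\<close>

lemma reflect_line_step:
  "distr (line_step p r t l) line_space (\<lambda>l j. l (1 - j)) = line_step p r t (\<lambda>j. l (1 - j))"
  by (simp add: line_step_eq_pair_product reflect_pair_product swap_pair_step add.commute)

section \<open>Finite marginals and the Markov property of the chain\<close>

text \<open>Transfers integrals of functions of the first \<open>n\<close> lines from the projective
  limit to the iterated kernel \<open>C\<close>, where the last step can be peeled off.\<close>

lemma nn_integral_chain_law:
  fixes f :: "(nat \<Rightarrow> line) \<Rightarrow> ennreal"
  assumes \<mu>: "\<mu> \<in> space (prob_algebra line_space)"
    and f [measurable]: "f \<in> borel_measurable (Pi\<^sub>M {0..<n} (\<lambda>_. line_space))"
  shows "(\<integral>\<^sup>+h. f (restrict h {0..<n}) \<partial>chain_law \<mu> p r)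
    = (\<integral>\<^sup>+h. f h \<partial>Ionescu_Tulcea.C (line_kernel \<mu> p r) (\<lambda>_. line_space) 0 n (\<lambda>_. undefined))"
proof -
  interpret Ionescu_Tulcea "line_kernel \<mu> p r" "\<lambda>_. line_space"
    by (rule line_kernel_Ionescu_Tulcea[OF \<mu>])
  let ?P = "Pi\<^sub>M {0..<n} (\<lambda>_. line_space)"
  \<comment> \<open>The horizon from which \<open>CI {0..<n}\<close> is built is \<open>n\<close>
    itself, so the restriction in \<open>CI\<close> changes nothing and \<open>CI {0..<n}\<close> is
    \<open>C 0 n\<close>.\<close>
  have up: "up_to {0..<n} = n"
    using up_to[of "{0..<n}"] by (intro antisym) (auto simp: up_to_iff_Ico)
  have "distr (C 0 n (\<lambda>_. undefined)) ?P (\<lambda>f. restrict f {0..<n}) = C 0 n (\<lambda>_. undefined)"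
    using distr_C[of n n "\<lambda>_. undefined" 0] by simp
  then have CI: "CI {0..<n} = C 0 n (\<lambda>_. undefined)"
    by (simp add: CI_def up)
  have "distr PF.lim ?P (\<lambda>h. restrict h {0..<n}) = CI {0..<n}"
  proof (rule measure_eqI)
    fix X assume "X \<in> sets (distr PF.lim ?P (\<lambda>h. restrict h {0..<n}))"
    then have X: "X \<in> sets ?P" by simp
    have "emeasure (distr PF.lim ?P (\<lambda>h. restrict h {0..<n})) X
        = emeasure PF.lim (PF.emb UNIV {0..<n} X)"
      using X by (intro emeasure_distr_restrict) auto
    then show "emeasure (distr PF.lim ?P (\<lambda>h. restrict h {0..<n})) X = emeasure (CI {0..<n}) X"
      using lim[OF _ X] by simp
  qed (simp add: CI_def)
  then have "C 0 n (\<lambda>_. undefined) = distr PF.lim ?P (\<lambda>h. restrict h {0..<n})"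
    by (simp add: CI)
  moreover have "(\<lambda>h. restrict h {0..<n}) \<in> measurable PF.lim ?P"
    by (subst measurable_cong_sets[OF PF.sets_lim refl]) (auto intro: measurable_restrict_subset)
  ultimately show ?thesis
    by (simp add: chain_law_def nn_integral_distr)
qed

lemma chain_law_initial:
  assumes \<mu>: "\<mu> \<in> space (prob_algebra line_space)"
    and [measurable]: "G \<in> borel_measurable line_space"
  shows "(\<integral>\<^sup>+h. G (h 0) \<partial>chain_law \<mu> p r) = (\<integral>\<^sup>+l. G l \<partial>\<mu>)"
proof -
  interpret Ionescu_Tulcea "line_kernel \<mu> p r" "\<lambda>_. line_space"
    by (rule line_kernel_Ionescu_Tulcea[OF \<mu>])
  have "(\<integral>\<^sup>+h. G (h 0) \<partial>chain_law \<mu> p r) = (\<integral>\<^sup>+h. G (h 0) \<partial>C 0 1 (\<lambda>_. undefined))"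
    using nn_integral_chain_law[OF \<mu>, of "\<lambda>h. G (h 0)" 1 p r] by simp
  also have "C 0 1 (\<lambda>_. undefined) = eP 0 (\<lambda>_. undefined)"
    using bind_return[OF measurable_eP, of "\<lambda>_. undefined" 0] by simp
  also have "(\<integral>\<^sup>+h. G (h 0) \<partial>eP 0 (\<lambda>_. undefined)) = (\<integral>\<^sup>+l. G l \<partial>\<mu>)"
    by (subst nn_integral_eP) (auto simp: line_kernel_def)
  finally show ?thesis .
qed

text \<open>The last kernel of the iterated law depends on the past only through line
  \<open>n\<close>. Keeping the factor \<open>F\<close> at one earlier time is enough for two-point
  probabilities.\<close>

lemma chain_law_Markov:
  assumes \<mu>: "\<mu> \<in> space (prob_algebra line_space)"
    and [measurable]: "F \<in> borel_measurable line_space" "G \<in> borel_measurable line_space"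
    and "t \<le> n"
  shows "(\<integral>\<^sup>+h. F (h t) * G (h (Suc n)) \<partial>chain_law \<mu> p r)
    = (\<integral>\<^sup>+h. F (h t) * (\<integral>\<^sup>+x. G x \<partial>line_step p r n (h n)) \<partial>chain_law \<mu> p r)"
proof -
  interpret Ionescu_Tulcea "line_kernel \<mu> p r" "\<lambda>_. line_space"
    by (rule line_kernel_Ionescu_Tulcea[OF \<mu>])
  let ?u = "\<lambda>_. undefined" and ?P = "\<lambda>n::nat. Pi\<^sub>M {0..<n} (\<lambda>_. line_space)"
  have u: "?u \<in> space (?P 0)" by simp
  have comp [measurable]: "(\<lambda>h. h i) \<in> measurable (?P m) line_space" if "i < m" for i m
    using that by (intro measurable_component_singleton) simp
  have FG [measurable]: "(\<lambda>h. F (h t) * G (h (Suc n))) \<in> borel_measurable (?P (Suc (Suc n)))"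
    using \<open>t \<le> n\<close> by (intro borel_measurable_times_ennreal)
        (auto intro: measurable_compose[OF comp])
  have K: "(\<lambda>l. \<integral>\<^sup>+x. G x \<partial>line_step p r n l) \<in> borel_measurable line_space"
    by measurable
  have FK: "(\<lambda>h. F (h t) * (\<integral>\<^sup>+x. G x \<partial>line_step p r n (h n))) \<in> borel_measurable (?P (Suc n))"
    using \<open>t \<le> n\<close> by (intro borel_measurable_times_ennreal)
        (auto intro: measurable_compose[OF comp] measurable_compose[OF comp K])
  \<comment> \<open>\<open>C 0 m\<close> generates lines \<open>0\<close> to \<open>m - 1\<close>,
    so reaching line \<open>Suc n\<close> takes \<open>Suc (Suc n)\<close> draws.\<close>
  have "(\<integral>\<^sup>+h. F (h t) * G (h (Suc n)) \<partial>chain_law \<mu> p r)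
      = (\<integral>\<^sup>+h. F (h t) * G (h (Suc n)) \<partial>C 0 (Suc (Suc n)) ?u)"
    using nn_integral_chain_law[OF \<mu> FG] \<open>t \<le> n\<close> by simp
  also have "\<dots> = (\<integral>\<^sup>+h. \<integral>\<^sup>+h'. F (h' t) * G (h' (Suc n)) \<partial>eP (Suc n) h \<partial>C 0 (Suc n) ?u)"
  proof -
    have "eP (Suc n) \<in> measurable (C 0 (Suc n) ?u) (subprob_algebra (?P (Suc (Suc n))))"
      using measurable_eP[of "Suc n"] by (simp only: measurable_cong_sets[OF sets_C[OF u] refl] add_0)
    from nn_integral_bind[OF FG this] show ?thesis by simp
  qed
  also have "\<dots> = (\<integral>\<^sup>+h. F (h t) * (\<integral>\<^sup>+x. G x \<partial>line_step p r n (h n)) \<partial>C 0 (Suc n) ?u)"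
  proof (rule nn_integral_cong)
    fix h assume "h \<in> space (C 0 (Suc n) ?u)"
    then have h: "h \<in> space (?P (Suc n))" using space_C[OF u, of "Suc n"] by simp
    \<comment> \<open>The extension by \<open>eP (Suc n)\<close> alters only coordinate
      \<open>Suc n\<close>. As \<open>t\<close> is smaller, \<open>F (h t)\<close> is a constant
      factor.\<close>
    show "(\<integral>\<^sup>+h'. F (h' t) * G (h' (Suc n)) \<partial>eP (Suc n) h)
        = F (h t) * (\<integral>\<^sup>+x. G x \<partial>line_step p r n (h n))"
      using \<open>t \<le> n\<close> by (subst nn_integral_eP[OF h FG])
        (simp add: line_kernel_def nn_integral_cmult line_step_eq_pair_product cong: measurable_cong_sets)
  qed
  also have "\<dots> = (\<integral>\<^sup>+h. F (h t) * (\<integral>\<^sup>+x. G x \<partial>line_step p r n (h n)) \<partial>chain_law \<mu> p r)"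
    using nn_integral_chain_law[OF \<mu> FK] \<open>t \<le> n\<close> by simp
  finally show ?thesis .
qed

section \<open>Two-time expectations and their equivariance\<close>

text \<open>Recursing at the last step lets the Markov property be applied once, at the latest time, with an
  arbitrary \<open>G\<close> in the induction hypothesis.\<close>

primrec evolve :: "real \<Rightarrow> real \<Rightarrow> nat \<Rightarrow> nat \<Rightarrow> (line \<Rightarrow> ennreal) \<Rightarrow> line \<Rightarrow> ennreal" where
  "evolve p r t 0 G = G"
| "evolve p r t (Suc k) G = evolve p r t k (\<lambda>l. \<integral>\<^sup>+x. G x \<partial>line_step p r (t + k) l)"

lemma measurable_evolve:
  "G \<in> borel_measurable line_space \<Longrightarrow> evolve p r t k G \<in> borel_measurable line_space"
proof (induction k arbitrary: G)
  case (Suc k)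
  note [measurable] = Suc.prems
  have "(\<lambda>l. \<integral>\<^sup>+x. G x \<partial>line_step p r (t + k) l) \<in> borel_measurable line_space"
    by measurable
  from Suc.IH[OF this] show ?case by simp
qed simp

lemma chain_law_evolve:
  assumes \<mu>: "\<mu> \<in> space (prob_algebra line_space)" and F: "F \<in> borel_measurable line_space"
    and G: "G \<in> borel_measurable line_space"
  shows "(\<integral>\<^sup>+h. F (h t) * G (h (t + k)) \<partial>chain_law \<mu> p r)
    = (\<integral>\<^sup>+h. F (h t) * evolve p r t k G (h t) \<partial>chain_law \<mu> p r)"
  using G
proof (induction k arbitrary: G)
  case (Suc k)
  note [measurable] = Suc.prems
  have K: "(\<lambda>l. \<integral>\<^sup>+x. G x \<partial>line_step p r (t + k) l) \<in> borel_measurable line_space"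
    by measurable
  show ?case
    using chain_law_Markov[OF \<mu> F Suc.prems, of t "t + k"] Suc.IH[OF K] by simp
qed simp

lemma chain_law_PM_stationary:
  assumes "G \<in> borel_measurable line_space"
  shows "(\<integral>\<^sup>+h. G (h t) \<partial>chain_law (PM (1/2)) p r) = (\<integral>\<^sup>+l. G l \<partial>PM (1/2))"
  using assms
proof (induction t arbitrary: G)
  case 0
  then show ?case by (rule chain_law_initial[OF PM_in_prob_algebra])
next
  case (Suc t)
  note [measurable] = Suc.prems
  have K: "(\<lambda>l. \<integral>\<^sup>+x. G x \<partial>line_step p r t l) \<in> borel_measurable line_space"
    by measurable
  show ?case
    \<comment> \<open>With \<open>F\<close> constantly 1 the Markov identity speaks of a single
      time; the induction hypothesis is then applied to the one-step integral of
      \<open>G\<close>.\<close>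
    using chain_law_Markov[OF PM_in_prob_algebra, of "\<lambda>_. 1" G t t] Suc.IH[OF K] Suc.prems
      nn_integral_PM_line_step[OF Suc.prems]
    by simp
qed

text \<open>The hypothesis moves \<open>\<phi>\<close> through one step while changing the clock
  from \<open>u\<close> to \<open>t\<close>; induction moves it through all \<open>k\<close>
  steps.\<close>

lemma evolve_equivariant:
  assumes \<phi>: "\<phi> \<in> measurable line_space line_space"
    and step: "\<And>k l. distr (line_step p r (u + k) l) line_space \<phi> = line_step p r (t + k) (\<phi> l)"
    and "G \<in> borel_measurable line_space"
  shows "evolve p r u k (\<lambda>l. G (\<phi> l)) l = evolve p r t k G (\<phi> l)"
  using assms(3)
proof (induction k arbitrary: G)
  case (Suc k)
  note [measurable] = Suc.prems
  have K: "(\<lambda>l. \<integral>\<^sup>+x. G x \<partial>line_step p r (t + k) l) \<in> borel_measurable line_space"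
    by measurable
  have "(\<integral>\<^sup>+x. G (\<phi> x) \<partial>line_step p r (u + k) l) = (\<integral>\<^sup>+x. G x \<partial>line_step p r (t + k) (\<phi> l))" for l
    unfolding step[symmetric] using \<phi> Suc.prems
    by (subst nn_integral_distr) (simp_all add: line_step_eq_pair_product cong: measurable_cong_sets)
  then show ?case using Suc.IH[OF K] by simp
qed simp

text \<open>Both sides reduce to integrals over one line with law PM(1/2), by
  \<open>chain_law_evolve\<close> and stationarity. There \<open>\<phi>\<close> is pulled out of the
  evolution and absorbed by the invariance of PM(1/2).\<close>

lemma chain_law_equivariant:
  assumes \<phi>: "\<phi> \<in> measurable line_space line_space"
    and PM: "distr (PM (1/2)) line_space \<phi> = PM (1/2)"
    and step: "\<And>k l. distr (line_step p r (u + k) l) line_space \<phi> = line_step p r (t + k) (\<phi> l)"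
    and F: "F \<in> borel_measurable line_space" and G: "G \<in> borel_measurable line_space"
  shows "(\<integral>\<^sup>+h. F (\<phi> (h u)) * G (\<phi> (h (u + k))) \<partial>chain_law (PM (1/2)) p r)
    = (\<integral>\<^sup>+h. F (h t) * G (h (t + k)) \<partial>chain_law (PM (1/2)) p r)"
proof -
  note [measurable] = \<phi> F G measurable_evolve[OF G]
  have G': "(\<lambda>l. G (\<phi> l)) \<in> borel_measurable line_space"
      and F': "(\<lambda>l. F (\<phi> l)) \<in> borel_measurable line_space"
    by measurable
  note [measurable] = measurable_evolve[OF G']
  have "(\<integral>\<^sup>+h. F (\<phi> (h u)) * G (\<phi> (h (u + k))) \<partial>chain_law (PM (1/2)) p r)
      = (\<integral>\<^sup>+l. F (\<phi> l) * evolve p r u k (\<lambda>l. G (\<phi> l)) l \<partial>PM (1/2))"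
    unfolding chain_law_evolve[OF PM_in_prob_algebra F' G']
    by (rule chain_law_PM_stationary) measurable
  also have "\<dots> = (\<integral>\<^sup>+l. F (\<phi> l) * evolve p r t k G (\<phi> l) \<partial>PM (1/2))"
    by (simp add: evolve_equivariant[OF \<phi> step G])
  also have "\<dots> = (\<integral>\<^sup>+l. F l * evolve p r t k G l \<partial>distr (PM (1/2)) line_space \<phi>)"
    by (subst nn_integral_distr) (simp_all cong: measurable_cong_sets)
  also have "\<dots> = (\<integral>\<^sup>+h. F (h t) * G (h (t + k)) \<partial>chain_law (PM (1/2)) p r)"
    unfolding PM chain_law_evolve[OF PM_in_prob_algebra F G]
    by (rule chain_law_PM_stationary[symmetric]) measurable
  finally show ?thesis .
qed

section \<open>The law of the field and its two-point probabilities\<close>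

lemma prob_space_chain_law:
  assumes "\<mu> \<in> space (prob_algebra line_space)"
  shows "prob_space (chain_law \<mu> p r)"
proof (rule prob_spaceI)
  have "prob_space \<mu>" using assms by (simp add: space_prob_algebra)
  then have "emeasure \<mu> (space \<mu>) = 1" by (rule prob_space.emeasure_space_1)
  then show "emeasure (chain_law \<mu> p r) (space (chain_law \<mu> p r)) = 1"
    using chain_law_initial[OF assms, of "\<lambda>_. 1" p r] by simp
qed

lemma sets_chain_law:
  assumes "\<mu> \<in> space (prob_algebra line_space)"
  shows "sets (chain_law \<mu> p r) = sets (Pi\<^sub>M UNIV (\<lambda>_. line_space))"
proof -
  interpret Ionescu_Tulcea "line_kernel \<mu> p r" "\<lambda>_. line_space"
    by (rule line_kernel_Ionescu_Tulcea[OF assms])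
  show ?thesis by (simp add: chain_law_def PF.sets_lim)
qed

lemma measurable_field:
  assumes "\<mu> \<in> space (prob_algebra line_space)"
  shows "(\<lambda>h (i, t). h t i) \<in> measurable (chain_law \<mu> p r) field_space"
proof -
  have "(\<lambda>h (i, t). h t i) \<in> measurable (Pi\<^sub>M UNIV (\<lambda>_::nat. line_space)) field_space"
  proof (rule measurable_PiM_single')
    fix v :: "int \<times> nat"
    have "(\<lambda>h. h (snd v) (fst v)) \<in> measurable (Pi\<^sub>M UNIV (\<lambda>_::nat. line_space)) (count_space UNIV)"
      by (rule measurable_compose[OF measurable_component_singleton[of "snd v" UNIV "\<lambda>_. line_space"]
            measurable_component_singleton[of "fst v" UNIV "\<lambda>_. count_space UNIV"]]) simp_all
    then show "(\<lambda>h. (case v of (i, t) \<Rightarrow> h t i)) \<in> measurable (Pi\<^sub>M UNIV (\<lambda>_::nat. line_space)) (count_space UNIV)"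
      by (simp add: case_prod_beta)
  qed auto
  then show ?thesis by (simp cong: measurable_cong_sets add: sets_chain_law[OF assms])
qed

lemma sets_field: "{e. e u \<and> e v} \<in> sets field_space"
proof -
  have "{e \<in> space field_space. e u \<and> e v} \<in> sets field_space"
    by (intro sets.sets_Collect_conj) measurable
  then show ?thesis by (simp add: space_PiM)
qed

lemma emeasure_field_law:
  assumes "\<mu> \<in> space (prob_algebra line_space)"
  shows "emeasure (field_law \<mu> p r) {e. e (i, t) \<and> e (j, t')}
    = (\<integral>\<^sup>+h. indicator {l. l i} (h t) * indicator {l. l j} (h t') \<partial>chain_law \<mu> p r)"
proof -
  have "emeasure (field_law \<mu> p r) {e. e (i, t) \<and> e (j, t')}
      = (\<integral>\<^sup>+e. indicator {e. e (i, t) \<and> e (j, t')} e \<partial>field_law \<mu> p r)"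
    by (simp add: field_law_def sets_field)
  also have "\<dots> = (\<integral>\<^sup>+h. indicator {l. l i} (h t) * indicator {l. l j} (h t') \<partial>chain_law \<mu> p r)"
    unfolding field_law_def
    by (subst nn_integral_distr[OF measurable_field[OF assms]])
       (auto simp: sets_field intro!: nn_integral_cong split: split_indicator)
  finally show ?thesis .
qed

lemma field_law_equivariant:
  assumes PM: "distr (PM (1/2)) line_space (\<lambda>l j. l (\<sigma> j)) = PM (1/2)"
    and step: "\<And>k l. distr (line_step p r (u + k) l) line_space (\<lambda>l j. l (\<sigma> j))
      = line_step p r (t + k) (\<lambda>j. l (\<sigma> j))"
  shows "emeasure (field_law (PM (1/2)) p r) {e. e (\<sigma> i, u) \<and> e (\<sigma> j, u + k)}
    = emeasure (field_law (PM (1/2)) p r) {e. e (i, t) \<and> e (j, t + k)}"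
proof -
  have ind: "indicator {l. l i} \<in> borel_measurable line_space" for i
    using sets_Collect_single'[of i UNIV "\<lambda>_. count_space UNIV" "\<lambda>x. x"] by simp
  show ?thesis
    using chain_law_equivariant[OF measurable_relabel PM step ind[of i] ind[of j]]
    by (simp add: emeasure_field_law[OF PM_in_prob_algebra] indicator_def)
qed

text \<open>Removes the time ordering: when \<open>t'\<close> is the earlier time, the two events
  exchange roles. The parameter \<open>d\<close> is the time shift that accompanies the relabelling
  \<open>\<sigma>\<close> of sites.\<close>

lemma field_law_symmetry:
  assumes "distr (PM (1/2)) line_space (\<lambda>l j. l (\<sigma> j)) = PM (1/2)"
    and "\<And>s l. distr (line_step p r (s + d) l) line_space (\<lambda>l j. l (\<sigma> j))
      = line_step p r s (\<lambda>j. l (\<sigma> j))"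
  shows "measure (field_law (PM (1/2)) p r) {e. e (\<sigma> i, t + d) \<and> e (\<sigma> i', t' + d)}
    = measure (field_law (PM (1/2)) p r) {e. e (i, t) \<and> e (i', t')}"
proof -
  let ?P = "field_law (PM (1/2)) p r"
  have *: "measure ?P {e. e (\<sigma> i, t + d) \<and> e (\<sigma> j, t + k + d)}
      = measure ?P {e. e (i, t) \<and> e (j, t + k)}"
    for i j t k
    using field_law_equivariant[OF assms(1), of p r "t + d" t i j k] assms(2)[of "t + _"]
    by (simp add: measure_def ac_simps)
  show ?thesis
  proof (cases "t \<le> t'")
    case True
    then show ?thesis using *[of i t i' "t' - t"] by simp
  next
    case False
    then show ?thesis using *[of i' t' i "t - t'"] by (simp add: conj_commute)
  qed
qed

section \<open>Correlations as functions of two-point probabilities\<close>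

text \<open>One-point probabilities are written as two-point ones with \<open>u\<close> repeated, so
  that an invariance of two-point probabilities covers every term.\<close>

lemma covariance_P8:
  "covariance (P8 a b c d) (\<lambda>e. of_bool (e u)) (\<lambda>e. of_bool (e v))
    = measure (P8 a b c d) {e. e u \<and> e v}
      - measure (P8 a b c d) {e. e u \<and> e u} * measure (P8 a b c d) {e. e v \<and> e v}"
proof -
  let ?P = "P8 a b c d"
  interpret prob_space ?P
    unfolding P8_def field_law_def
    by (intro prob_space.prob_space_distr prob_space_chain_law measurable_field PM_in_prob_algebra)
  have sets: "{e. e u \<and> e v} \<in> events" for u v
    by (simp add: P8_def field_law_def sets_field)
  have ind: "(\<lambda>e. of_bool (e u \<and> e v)) = (indicator {e. e u \<and> e v} :: field \<Rightarrow> real)" for u v :: "int \<times> nat"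
    by (auto simp: fun_eq_iff)
  have int: "integrable ?P (\<lambda>e. of_bool (e u \<and> e v) :: real)"
    and E: "expectation (\<lambda>e. of_bool (e u \<and> e v)) = prob {e. e u \<and> e v}" for u v
    unfolding ind using sets[of u v] by (simp_all add: emeasure_eq_measure)
  have int1: "integrable ?P (\<lambda>e. of_bool (e u) :: real)"
    and E1: "expectation (\<lambda>e. of_bool (e u)) = prob {e. e u \<and> e u}" for u
    using int[of u u] E[of u u] by simp_all
  define x y where "x = prob {e. e u \<and> e u}" and "y = prob {e. e v \<and> e v}"
  have "covariance ?P (\<lambda>e. of_bool (e u)) (\<lambda>e. of_bool (e v))
      = expectation (\<lambda>e. of_bool (e u \<and> e v) - x * of_bool (e v) - y * of_bool (e u) + x * y)"
    unfolding covariance_def E1 x_def[symmetric] y_def[symmetric]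
    by (simp add: algebra_simps of_bool_conj)
  also have "\<dots> = prob {e. e u \<and> e v} - x * y - y * x + x * y"
    using int[of u v] int1[of u] int1[of v] E[of u v] E1[of u] E1[of v]
    by (simp add: x_def y_def prob_space)
  finally show ?thesis by (simp add: x_def y_def)
qed

text \<open>Each variance is the covariance of a variable with itself, so
  \<open>covariance_P8\<close> expresses the whole quotient through these three kinds of
  probabilities.\<close>

lemma C8_eqI:
  assumes "measure (P8 a b c d) {e. e u \<and> e v} = measure (P8 a b c d) {e. e u' \<and> e v'}"
    and "measure (P8 a b c d) {e. e u \<and> e u} = measure (P8 a b c d) {e. e u' \<and> e u'}"
    and "measure (P8 a b c d) {e. e v \<and> e v} = measure (P8 a b c d) {e. e v' \<and> e v'}"
  shows "C8 a b c d u v = C8 a b c d u' v'"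
proof -
  have "C8 a b c d u v = covariance (P8 a b c d) (\<lambda>e. of_bool (e u)) (\<lambda>e. of_bool (e v)) /
     (sqrt (covariance (P8 a b c d) (\<lambda>e. of_bool (e u)) (\<lambda>e. of_bool (e u))) *
      sqrt (covariance (P8 a b c d) (\<lambda>e. of_bool (e v)) (\<lambda>e. of_bool (e v))))" for u v
    by (simp add: C8_def covariance_def power2_eq_square)
  then show ?thesis
    using assms by (simp only: covariance_P8)
qed

theorem proposition1p8:
  fixes a b c d :: real and i i' :: int and t t' :: nat
  assumes "0 \<le> a" "0 \<le> b" "0 \<le> c" "0 \<le> d"
    and "\<not> (a = 0 \<and> b = 0 \<and> c = 0 \<and> d = 0)"
    and "a + c = b + d"
  shows "C8 a b c d (i, t) (i', t') = C8 a b c d (i', t') (i, t)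
    \<and> C8 a b c d (0, t) (i', t') = C8 a b c d (1, t) (1 - i', t')
    \<and> C8 a b c d (i, t) (i', t') = C8 a b c d (i + 2, t) (i' + 2, t')
    \<and> C8 a b c d (i, t) (i', t') = C8 a b c d (i + 1, t + 1) (i' + 1, t' + 1)"
proof (intro conjI)
  show "C8 a b c d (i, t) (i', t') = C8 a b c d (i', t') (i, t)"
    by (simp add: C8_def covariance_def mult.commute)
  have reflect: "measure (P8 a b c d) {e. e (1 - j, s) \<and> e (1 - j', s')}
      = measure (P8 a b c d) {e. e (j, s) \<and> e (j', s')}" for j j' s s'
    using field_law_symmetry[where \<sigma>="\<lambda>j. 1 - j" and d=0, OF reflect_PM]
    by (simp add: P8_def reflect_line_step)
  show "C8 a b c d (0, t) (i', t') = C8 a b c d (1, t) (1 - i', t')"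
    using reflect[of 0 t i' t'] reflect[of 0 t 0 t] reflect[of i' t' i' t']
    by (intro C8_eqI) simp_all
  \<comment> \<open>An even shift preserves the pairing of each line, so no time shift is
    involved.\<close>
  have shift2: "measure (P8 a b c d) {e. e (j + 2, s) \<and> e (j' + 2, s')}
      = measure (P8 a b c d) {e. e (j, s) \<and> e (j', s')}" for j j' s s'
    using field_law_symmetry[where \<sigma>="\<lambda>j. j + 2" and d=0, OF shift_PM]
    by (simp add: P8_def shift_line_step)
  show "C8 a b c d (i, t) (i', t') = C8 a b c d (i + 2, t) (i' + 2, t')"
    by (rule C8_eqI) (rule shift2[symmetric])+
  \<comment> \<open>A shift by one site exchanges the two pairings, which one time step compensates:
    \<open>1 + (s + 1) + s\<close> is even.\<close>
  have shift1: "measure (P8 a b c d) {e. e (j + 1, s + 1) \<and> e (j' + 1, s' + 1)}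
      = measure (P8 a b c d) {e. e (j, s) \<and> e (j', s')}" for j j' s s'
    unfolding P8_def
    by (rule field_law_symmetry[where \<sigma>="\<lambda>j. j + 1", OF shift_PM]) (rule shift_line_step, simp)
  show "C8 a b c d (i, t) (i', t') = C8 a b c d (i + 1, t + 1) (i' + 1, t' + 1)"
    by (rule C8_eqI) (rule shift1[symmetric])+
qed

end
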